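(* Let $\ell\ge 1$ be an integer, $T>0$, and let $u=(u_{\ell+1},u_{\ell+2},\dots)$ be a pre-gelation large-cluster solution on $[0,T]$, all of whose moments exist on $[0,T]$ (with uniformly convergent series). Then for every integer $k\ge 1$, on $[0,T]$, $$\dot m_k =\frac1{m_1^2} \sum_{n,j \ge \ell +1} \big[(n+j-\ell)^k -2n^{k} \big]\,n j\,u_ju_n = - 2\frac{m_{k+1}}{m_1}+ \sum_{q+r+s = k} \binom{k}{q,r,s} \frac{m_{r+1}m_{s+1}}{m_1^2}(-\ell)^{q},$$ where the last sum is over nonnegative integers $q,r,s$ with $q+r+s=k$ and $\binom{k}{q,r,s}=\frac{k!}{q!\,r!\,s!}$.
   Context: The moments of $u$ are $m_k(t)=\sum_{i\ge \ell+1} i^k u_i(t)$. A large-cluster solution on $[0,T]$ is a sequence of nonnegative functions $u_k\in C^1([0,T],[0,1])$, $k\ge \ell+1$, satisfying $$\dot u_n = \sum_{i = \ell+1}^{n-1} \frac{i(n+\ell-i)}{m_1(t)^2}u_i u_{n+\ell - i} - \frac{2nu_n}{m_1(t)},\qquad n\ge \ell+1$$ (empty sum for $n=\ell+1$; $0<m_1(t)<\infty$), with initial conditions $u_n(0)=u_n^0\ge 0$, $\sum_{n\ge \ell+1} u_n^0=1$. It is a pre-gelation solution if the series $m_2(t)=\sum_i i^2u_i(t)$ converges uniformly for $t\in[0,T]$. *)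

theory Defs imports "HOL-Analysis.Analysis" begin

text \<open>Families \<open>u :: nat \<Rightarrow> real \<Rightarrow> real\<close> stand for \<open>(u n t)\<close> with \<open>n \<ge> l + 1\<close>; the values at
  indices \<open>n \<le> l\<close> are never used.\<close>

definition moment :: "nat \<Rightarrow> (nat \<Rightarrow> real \<Rightarrow> real) \<Rightarrow> nat \<Rightarrow> real \<Rightarrow> real" where
  "moment l u k t = (\<Sum>\<^sub>\<infinity>i\<in>{l+1..}. real i ^ k * u i t)"

definition moment_converges_uniformly ::
    "nat \<Rightarrow> real \<Rightarrow> (nat \<Rightarrow> real \<Rightarrow> real) \<Rightarrow> nat \<Rightarrow> bool" where
  "moment_converges_uniformly l T u k \<longleftrightarrow>
     uniformly_convergent_on {0..T} (\<lambda>N t. \<Sum>i=l+1..N. real i ^ k * u i t)"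

text \<open>Derivatives are taken relative to the interval, i.e. one-sided at its endpoints; the library
  notion \<open>C1_differentiable_on\<close> would demand two-sided derivatives there.\<close>

definition C1_on_interval :: "real \<Rightarrow> (real \<Rightarrow> real) \<Rightarrow> bool" where
  "C1_on_interval T f \<longleftrightarrow>
     (\<exists>f'. (\<forall>t\<in>{0..T}. (f has_real_derivative f' t) (at t within {0..T})) \<and>
           continuous_on {0..T} f')"

text \<open>For \<open>l + 1 \<le> i < n\<close> the natural-number subtraction \<open>n + l - i\<close> is exact and at least
  \<open>l + 1\<close>.\<close>

definition large_cluster_rhs :: "nat \<Rightarrow> (nat \<Rightarrow> real \<Rightarrow> real) \<Rightarrow> nat \<Rightarrow> real \<Rightarrow> real" where
  "large_cluster_rhs l u n t =
     (\<Sum>i\<in>{l+1..<n}. real i * real (n + l - i) / (moment l u 1 t)\<^sup>2 * u i t * u (n + l - i) t)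
     - 2 * real n * u n t / moment l u 1 t"

definition large_cluster_solution ::
    "nat \<Rightarrow> real \<Rightarrow> (nat \<Rightarrow> real) \<Rightarrow> (nat \<Rightarrow> real \<Rightarrow> real) \<Rightarrow> bool" where
  "large_cluster_solution l T u0 u \<longleftrightarrow>
     (\<forall>n\<ge>l+1. C1_on_interval T (u n) \<and> u n ` {0..T} \<subseteq> {0..1}) \<and>
     (\<forall>t\<in>{0..T}. (\<lambda>i. real i * u i t) summable_on {l+1..} \<and> 0 < moment l u 1 t) \<and>
     (\<forall>n\<ge>l+1. \<forall>t\<in>{0..T}.
        (u n has_real_derivative large_cluster_rhs l u n t) (at t within {0..T})) \<and>
     (\<forall>n\<ge>l+1. u n 0 = u0 n \<and> 0 \<le> u0 n) \<and>
     (u0 has_sum 1) {l+1..}"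

definition pre_gelation_solution ::
    "nat \<Rightarrow> real \<Rightarrow> (nat \<Rightarrow> real) \<Rightarrow> (nat \<Rightarrow> real \<Rightarrow> real) \<Rightarrow> bool" where
  "pre_gelation_solution l T u0 u \<longleftrightarrow>
     large_cluster_solution l T u0 u \<and> moment_converges_uniformly l T u 2"

end

theory Submission imports Defs begin

text \<open>The moments are continuous, hence bounded, on \<open>[0, T]\<close>, so the \<open>u\<^sub>n\<close> decay faster than any
  power of \<open>n\<close>, uniformly in \<open>t\<close>. The derivatives of the terms \<open>n\<^sup>k u\<^sub>n\<close> are then dominated by a
  multiple of \<open>n\<^sup>-\<^sup>2\<close>, which justifies termwise differentiation of \<open>m\<^sub>k\<close>. The gain term is
  rearranged through \<open>(n, i) \<mapsto> (i, n + l - i)\<close> into a double sum over all pairs of cluster sizes,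
  and the trinomial theorem factors this double sum into products of moments.\<close>

section \<open>Unordered sums of real families over tails and products\<close>

lemma has_sum_atLeast_imp_sums:
  fixes f :: "nat \<Rightarrow> real"
  assumes "(f has_sum S) {m..}"
  shows "(\<lambda>n. if m \<le> n then f n else 0) sums S"
proof -
  have "((\<lambda>n. if m \<le> n then f n else 0) has_sum S) UNIV \<longleftrightarrow> (f has_sum S) {m..}"
    by (rule has_sum_cong_neutral) auto
  then show ?thesis using assms has_sum_imp_sums by blast
qed

text \<open>For nonnegative terms, convergence in the natural order is already unconditional. This
  links the convergence hypotheses, stated for partial sums, to the moments, defined as unordered
  sums.\<close>

lemma nonneg_tendsto_imp_has_sum_atLeast:
  fixes f :: "nat \<Rightarrow> real"
  assumes lim: "(\<lambda>N. \<Sum>i=m..N. f i) \<longlonglongrightarrow> S" and nonneg: "\<And>i. i \<ge> m \<Longrightarrow> f i \<ge> 0"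
  shows "(f has_sum S) {m..}"
proof -
  define g where "g n = (if m \<le> n then f n else 0)" for n
  have "(\<Sum>i<Suc N. g i) = (\<Sum>i=m..N. f i)" for N
    unfolding g_def by (rule sum.mono_neutral_cong_right) auto
  with lim have "(\<lambda>N. \<Sum>i<Suc N. g i) \<longlonglongrightarrow> S" by simp
  then have "g sums S"
    unfolding sums_def by (subst (asm) filterlim_sequentially_Suc)
  then have "(g has_sum S) UNIV"
    by (rule sums_nonneg_imp_has_sum) (simp add: g_def nonneg)
  also have "(g has_sum S) UNIV \<longleftrightarrow> (f has_sum S) {m..}"
    by (rule has_sum_cong_neutral) (auto simp: g_def)
  finally show ?thesis .
qed

lemma has_sum_sum_finite:
  fixes f :: "'i \<Rightarrow> 'a \<Rightarrow> 'b :: topological_comm_monoid_add"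
  assumes "finite I" and "\<And>i. i \<in> I \<Longrightarrow> (f i has_sum s i) A"
  shows "((\<lambda>x. \<Sum>i\<in>I. f i x) has_sum (\<Sum>i\<in>I. s i)) A"
  using assms by (induction I rule: finite_induct) (auto intro: has_sum_add)

lemma has_sum_diff:
  fixes f g :: "'a \<Rightarrow> real"
  assumes "(f has_sum a) A" "(g has_sum b) A"
  shows "((\<lambda>x. f x - g x) has_sum (a - b)) A"
  using has_sum_add[OF assms(1) has_sum_uminusI[OF assms(2)]] by simp

text \<open>Tonelli: by nonnegativity, summability of the row sums gives summability on the product,
  and the iterated sum is then its value.\<close>

lemma has_sum_times_nonneg:
  fixes f :: "'a \<Rightarrow> real" and g :: "'b \<Rightarrow> real"
  assumes f: "(f has_sum a) A" and g: "(g has_sum b) B"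
    and f0: "\<And>x. x \<in> A \<Longrightarrow> f x \<ge> 0" and g0: "\<And>y. y \<in> B \<Longrightarrow> g y \<ge> 0"
  shows "((\<lambda>(x, y). f x * g y) has_sum (a * b)) (A \<times> B)"
proof (rule has_sum_SigmaI)
  show inner: "((\<lambda>y. case (x, y) of (x, y) \<Rightarrow> f x * g y) has_sum f x * b) B" for x
    using has_sum_cmult_right[OF g, of "f x"] by simp
  show outer: "((\<lambda>x. f x * b) has_sum a * b) A"
    by (rule has_sum_cmult_left[OF f])
  show "(\<lambda>(x, y). f x * g y) summable_on A \<times> B"
    by (rule summable_on_SigmaI[OF inner has_sum_imp_summable[OF outer]]) (auto simp: f0 g0)
qed

section \<open>Trinomial expansion\<close>

lemma finite_triples_sum_eq: "finite {(q, r, s). q + r + s = (k :: nat)}"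
  by (rule finite_subset[of _ "{..k} \<times> {..k} \<times> {..k}"]) auto

text \<open>Two binomial expansions, first of x against y + z, then of y + z; the two binomial
  coefficients multiply to the trinomial one.\<close>

lemma trinomial:
  fixes x y z :: "'a :: field_char_0"
  shows "(x + y + z) ^ k =
    (\<Sum>(q, r, s)\<in>{(q, r, s). q + r + s = k}.
       fact k / (fact q * fact r * fact s) * x ^ q * y ^ r * z ^ s)"
proof -
  have "(x + y + z) ^ k = (\<Sum>q\<le>k. of_nat (k choose q) * x ^ q * (y + z) ^ (k - q))"
    by (simp add: add.assoc binomial_ring)
  also have "\<dots> = (\<Sum>q\<le>k. \<Sum>r\<le>k - q. of_nat (k choose q) * of_nat ((k - q) choose r)
      * x ^ q * y ^ r * z ^ (k - q - r))"
    by (simp add: binomial_ring sum_distrib_left mult_ac)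
  also have "\<dots> = (\<Sum>(q, r)\<in>Sigma {..k} (\<lambda>q. {..k - q}).
      of_nat (k choose q) * of_nat ((k - q) choose r) * x ^ q * y ^ r * z ^ (k - q - r))"
    by (simp add: sum.Sigma)
  also have "\<dots> = (\<Sum>(q, r, s)\<in>{(q, r, s). q + r + s = k}.
       fact k / (fact q * fact r * fact s) * x ^ q * y ^ r * z ^ s)"
    by (rule sum.reindex_bij_witness[of _ "\<lambda>(q, r, s). (q, r)" "\<lambda>(q, r). (q, r, k - q - r)"])
      (auto simp: binomial_fact)
  finally show ?thesis .
qed

section \<open>Continuity and bounds of the moments, decay of the rates\<close>

locale moments_convergent =
  fixes l :: nat and T :: real and u0 :: "nat \<Rightarrow> real" and u :: "nat \<Rightarrow> real \<Rightarrow> real"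
  assumes T_pos: "T > 0" and l_pos: "l \<ge> 1"
    and solution: "large_cluster_solution l T u0 u"
    and moments: "\<And>p. moment_converges_uniformly l T u p"
begin

lemma u_nonneg: "n \<ge> l + 1 \<Longrightarrow> t \<in> {0..T} \<Longrightarrow> u n t \<ge> 0"
  using solution unfolding large_cluster_solution_def image_subset_iff by auto

lemma u_deriv:
  "n \<ge> l + 1 \<Longrightarrow> t \<in> {0..T} \<Longrightarrow>
    (u n has_real_derivative large_cluster_rhs l u n t) (at t within {0..T})"
  using solution unfolding large_cluster_solution_def by blast

lemma moment_one_pos: "t \<in> {0..T} \<Longrightarrow> moment l u 1 t > 0"
  using solution unfolding large_cluster_solution_def by blast

text \<open>\<open>moment\<close> is an \<open>infsum\<close>, which defaults to 0 for a
  non-summable family, so its value carries information only once summability is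
  established.\<close>

lemma has_sum_moment:
  assumes "t \<in> {0..T}"
  shows "((\<lambda>i. real i ^ p * u i t) has_sum moment l u p t) {l+1..}"
proof -
  obtain L where "(\<lambda>N. \<Sum>i=l+1..N. real i ^ p * u i t) \<longlonglongrightarrow> L"
    using moments[of p] assms tendsto_uniform_limitI
    unfolding moment_converges_uniformly_def uniformly_convergent_on_def by fastforce
  then have "((\<lambda>i. real i ^ p * u i t) has_sum L) {l+1..}"
    by (rule nonneg_tendsto_imp_has_sum_atLeast) (use assms u_nonneg in auto)
  then show ?thesis
    unfolding moment_def by (metis has_sum_infsum has_sum_imp_summable)
qed

lemma continuous_on_moment: "continuous_on {0..T} (moment l u p)"
proof -
  let ?S = "\<lambda>N t. \<Sum>i=l+1..N. real i ^ p * u i t"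
  obtain L where L: "uniform_limit {0..T} ?S L sequentially"
    using moments[of p]
    unfolding moment_converges_uniformly_def uniformly_convergent_on_def by blast
  have "continuous_on {0..T} (u n)" if "n \<ge> l + 1" for n
    using u_deriv[OF that] DERIV_continuous continuous_on_eq_continuous_within by blast
  then have "\<forall>\<^sub>F N in sequentially. continuous_on {0..T} (?S N)"
    by (intro always_eventually allI continuous_intros) auto
  then have "continuous_on {0..T} L"
    using uniform_limit_theorem[OF _ L] by simp
  moreover have "L t = moment l u p t" if "t \<in> {0..T}" for t
  proof -
    have "?S \<comment> \<open>\<close> = ?S" by simp
    have "((\<lambda>i. real i ^ p * u i t) has_sum L t) {l+1..}"
      by (rule nonneg_tendsto_imp_has_sum_atLeast)
        (use that u_nonneg tendsto_uniform_limitI[OF L that] in auto)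
    then show ?thesis using has_sum_moment[OF that] has_sum_unique by blast
  qed
  ultimately show ?thesis using continuous_on_cong by (metis (no_types, lifting))
qed

lemma moment_bounded_above: obtains B where "B \<ge> 0" "\<And>t. t \<in> {0..T} \<Longrightarrow> moment l u p t \<le> B"
proof -
  have "bounded (moment l u p ` {0..T})"
    by (intro compact_imp_bounded compact_continuous_image continuous_on_moment) auto
  then obtain B where "\<And>t. t \<in> {0..T} \<Longrightarrow> norm (moment l u p t) \<le> B"
    unfolding bounded_iff by blast
  then have "moment l u p t \<le> max B 0" if "t \<in> {0..T}" for t
    using that by force
  then show thesis using that[of "max B 0"] by simp
qed

text \<open>A positive continuous function attains its minimum on the compact interval. This
  controls the denominators of the equation uniformly in time.\<close>

lemma moment_one_bounded_below:
  obtains c where "c > 0" "\<And>t. t \<in> {0..T} \<Longrightarrow> c \<le> moment l u 1 t"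
proof -
  obtain t0 where "t0 \<in> {0..T}" "\<And>t. t \<in> {0..T} \<Longrightarrow> moment l u 1 t0 \<le> moment l u 1 t"
    using continuous_attains_inf[OF _ _ continuous_on_moment, of 1] T_pos by auto
  then show thesis using that moment_one_pos by blast
qed

lemma power_times_u_le_moment:
  assumes "t \<in> {0..T}" "n \<ge> l + 1"
  shows "real n ^ p * u n t \<le> moment l u p t"
  using finite_sum_le_has_sum[OF has_sum_moment[OF assms(1)], of "{n}" p] assms u_nonneg by auto

text \<open>For \<open>i + j = n + l\<close> with \<open>i, j > l\<close> one has \<open>n \<le> i j\<close>, so a bound on a moment of
  sufficiently high order absorbs both the weight \<open>n ^ k\<close> and the number of summands.\<close>

lemma large_cluster_rhs_decay:
  obtains C where "\<And>n t. n \<ge> l + 1 \<Longrightarrow> t \<in> {0..T} \<Longrightarrow>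
    \<bar>real n ^ k * large_cluster_rhs l u n t\<bar> \<le> C / real n ^ 2"
proof -
  \<comment> \<open>The order is k + 4: k for the weight, 2 for the claimed decay, 1 for the number
    of summands, and 1 for the factor i or j in the coagulation kernel.\<close>
  obtain B where B: "B \<ge> 0" "\<And>t. t \<in> {0..T} \<Longrightarrow> moment l u (k + 4) t \<le> B"
    using moment_bounded_above by blast
  obtain c where c: "c > 0" "\<And>t. t \<in> {0..T} \<Longrightarrow> c \<le> moment l u 1 t"
    using moment_one_bounded_below by blast
  have "\<bar>real n ^ k * large_cluster_rhs l u n t\<bar> \<le> (B * B / c\<^sup>2 + 2 * B / c) / real n ^ 2"
    if n: "n \<ge> l + 1" and t: "t \<in> {0..T}" for n t
  proof -
    define m where "m = moment l u 1 t"
    have m: "m > 0" "c \<le> m" using c t by (auto simp: m_def intro: less_le_trans)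
    have n0: "real n > 0" "real n \<ge> 1" using n by auto
    have B': "real i ^ (k + 4) * u i t \<le> B" if "i \<ge> l + 1" for i
      using power_times_u_le_moment[OF t that] B(2)[OF t] by (rule order_trans)
    define G where "G i = real i * real (n + l - i) / m\<^sup>2 * u i t * u (n + l - i) t" for i
    have G: "0 \<le> G i \<and> real n ^ (k + 3) * G i \<le> B * B / c\<^sup>2" if i: "i \<in> {l+1..<n}" for i
    proof -
      define j where "j = n + l - i"
      have j: "j \<ge> l + 1" "i \<ge> l + 1" "n + l = i + j" using i by (auto simp: j_def)
      have u0: "u i t \<ge> 0" "u j t \<ge> 0" using j u_nonneg t by auto
      \<comment> \<open>With i = a + 1 and j = b + 1, l >= 1 gives n <= i + j - 1 = a + b + 1 <= (a
        + 1)(b + 1).\<close>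
      have "n \<le> i * j"
      proof -
        obtain a b where "i = Suc a" "j = Suc b" using j by (cases i; cases j) auto
        then show ?thesis using j l_pos by simp
      qed
      then have nij: "real n \<le> real i * real j"
        by (metis of_nat_le_iff of_nat_mult)
      have "real n ^ (k + 3) * (real i * real j * u i t * u j t)
          \<le> (real i * real j) ^ (k + 3) * (real i * real j * u i t * u j t)"
        by (intro mult_right_mono power_mono nij) (use u0 in auto)
      also have "\<dots> = (real i ^ (k + 4) * u i t) * (real j ^ (k + 4) * u j t)"
        by (simp add: power_mult_distrib algebra_simps eval_nat_numeral)
      also have "\<dots> \<le> B * B"
        by (intro mult_mono B' j B(1)) (use u0 in auto)
      finally have *: "real n ^ (k + 3) * (real i * real j * u i t * u j t) \<le> B * B" .
      have "real n ^ (k + 3) * G i = real n ^ (k + 3) * (real i * real j * u i t * u j t) / m\<^sup>2"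
        by (simp add: G_def j_def)
      also have "\<dots> \<le> B * B / c\<^sup>2"
        by (rule frac_le) (use * c m B(1) in \<open>auto intro: power_mono\<close>)
      finally show ?thesis using u0 by (simp add: G_def j_def)
    qed
    have G_sum: "real n ^ (k + 2) * (\<Sum>i\<in>{l+1..<n}. G i) \<le> B * B / c\<^sup>2"
    proof -
      \<comment> \<open>Fewer than n summands are each bounded after weighting by n^(k+3); the extra
        power of n pays for their number and is then cancelled.\<close>
      have "real n * (real n ^ (k + 2) * (\<Sum>i\<in>{l+1..<n}. G i))
          = (\<Sum>i\<in>{l+1..<n}. real n ^ (k + 3) * G i)"
        by (simp add: sum_distrib_left algebra_simps eval_nat_numeral)
      also have "\<dots> \<le> real (card {l+1..<n}) * (B * B / c\<^sup>2)"
        by (rule sum_bounded_above) (use G in auto)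
      also have "\<dots> \<le> real n * (B * B / c\<^sup>2)"
        by (rule mult_right_mono) auto
      finally show ?thesis by (rule mult_left_le_imp_le[OF _ n0(1)])
    qed
    have un: "u n t \<ge> 0" using u_nonneg n t by auto
    \<comment> \<open>The loss term needs only order k + 3, but since n >= 1 the same bound
      \<open>B\<close> serves.\<close>
    have "real n ^ (k + 3) * u n t \<le> real n ^ (k + 4) * u n t"
      by (intro mult_right_mono power_increasing n0 un) auto
    then have "2 * (real n ^ (k + 3) * u n t) / m \<le> 2 * B / c"
      using B'[OF n] m c B(1) by (intro frac_le) auto
    moreover have "0 \<le> 2 * (real n ^ (k + 3) * u n t) / m" using un m by simp
    moreover have "0 \<le> real n ^ (k + 2) * (\<Sum>i\<in>{l+1..<n}. G i)"
      using G by (intro mult_nonneg_nonneg sum_nonneg) auto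
    moreover have "real n ^ 2 * (real n ^ k * large_cluster_rhs l u n t)
        = real n ^ (k + 2) * (\<Sum>i\<in>{l+1..<n}. G i) - 2 * (real n ^ (k + 3) * u n t) / m"
      by (simp add: large_cluster_rhs_def G_def m_def algebra_simps eval_nat_numeral)
    ultimately have "\<bar>real n ^ 2 * (real n ^ k * large_cluster_rhs l u n t)\<bar>
        \<le> B * B / c\<^sup>2 + 2 * B / c"
      using G_sum by linarith
    then show ?thesis using n0 by (simp add: abs_mult field_simps)
  qed
  then show thesis using that by blast
qed

section \<open>Termwise differentiation of the moments\<close>

text \<open>The decay of the rates lets the Weierstrass M-test give uniform convergence of the
  differentiated series; the assumption on \<open>D\<close> only has to identify its sum.\<close>

lemma moment_deriv:
  assumes t: "t \<in> {0..T}"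
    and D: "((\<lambda>n. real n ^ k * large_cluster_rhs l u n t) has_sum D) {l+1..}"
  shows "(moment l u k has_real_derivative D) (at t within {0..T})"
proof -
  \<comment> \<open>The terms are extended by zero to indices n <= l, since the series theorems sum
    over all natural numbers.\<close>
  define f where "f n s = (if l + 1 \<le> n then real n ^ k * u n s else 0)" for n s
  define f' where "f' n s = (if l + 1 \<le> n then real n ^ k * large_cluster_rhs l u n s else 0)"
    for n s
  obtain C where C: "\<And>n s. n \<ge> l + 1 \<Longrightarrow> s \<in> {0..T} \<Longrightarrow>
    \<bar>real n ^ k * large_cluster_rhs l u n s\<bar> \<le> C / real n ^ 2"
    using large_cluster_rhs_decay by blast
  have lim: "uniform_limit {0..T} (\<lambda>N s. \<Sum>n<N. f' n s) (\<lambda>s. \<Sum>n. f' n s) sequentially"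
  proof (rule Weierstrass_m_test)
    \<comment> \<open>The sign of \<open>C\<close> is not known, hence the absolute value. At n = 0
      both sides vanish because \<open>inverse 0 = 0\<close>.\<close>
    show "norm (f' n s) \<le> \<bar>C\<bar> * inverse (real n ^ 2)" if "s \<in> {0..T}" for n s
    proof (cases "l + 1 \<le> n")
      case True
      have "\<bar>f' n s\<bar> \<le> C / real n ^ 2" using C[OF True that] True by (simp add: f'_def)
      also have "\<dots> \<le> \<bar>C\<bar> / real n ^ 2" by (rule divide_right_mono) auto
      finally show ?thesis by (simp add: divide_inverse)
    qed (simp add: f'_def)
    show "summable (\<lambda>n. \<bar>C\<bar> * inverse (real n ^ 2))"
      by (intro summable_mult inverse_power_summable) auto
  qed
  have f_sums: "(\<lambda>n. f n s) sums moment l u k s" if "s \<in> {0..T}" for s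
    using has_sum_atLeast_imp_sums[OF has_sum_moment[OF that]] by (simp add: f_def)
  have f_deriv: "(f n has_real_derivative f' n s) (at s within {0..T})" if "s \<in> {0..T}" for n s
    using u_deriv[OF _ that, of n] unfolding f_def f'_def
    by (auto intro!: DERIV_cmult)
  \<comment> \<open>The series theorem yields some limit function \<open>g\<close>; uniqueness of
    sums identifies it with the moment on the whole interval.\<close>
  obtain g where g: "\<And>s. s \<in> {0..T} \<Longrightarrow> (\<lambda>n. f n s) sums g s"
    "\<And>s. s \<in> {0..T} \<Longrightarrow> (g has_real_derivative (\<Sum>n. f' n s)) (at s within {0..T})"
    using has_field_derivative_series[OF _ f_deriv lim t] f_sums[OF t] sums_summable
    by (metis convex_real_interval(5))
  have "g s = moment l u k s" if "s \<in> {0..T}" for s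
    using g(1)[OF that] f_sums[OF that] sums_unique2 by blast
  moreover have "(\<Sum>n. f' n t) = D"
    using has_sum_atLeast_imp_sums[OF D] by (simp add: f'_def sums_iff)
  ultimately show ?thesis
    using has_field_derivative_transform_within[OF g(2)[OF t] zero_less_one t, of "moment l u k"] by simp
qed

section \<open>The gain term as a double sum\<close>

lemma has_sum_moment_times_moment:
  assumes t: "t \<in> {0..T}"
  shows "((\<lambda>(n, j). (real n ^ p * u n t) * (real j ^ q * u j t)) has_sum
    moment l u p t * moment l u q t) ({l+1..} \<times> {l+1..})"
  by (rule has_sum_times_nonneg[OF has_sum_moment[OF t] has_sum_moment[OF t]])
    (use u_nonneg[OF _ t] in auto)

text \<open>Expanding (-l + n + j)^k leaves finitely many products of a function of n and a function
  of j. The kernel factor n j raises the exponents to r + 1 and s + 1.\<close>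

lemma has_sum_coagulation_gain:
  assumes t: "t \<in> {0..T}"
  shows "((\<lambda>(n, j). (real n + real j - real l) ^ k * real n * real j * u j t * u n t) has_sum
    (\<Sum>(q, r, s)\<in>{(q, r, s). q + r + s = k}. fact k / (fact q * fact r * fact s)
        * (moment l u (r + 1) t * moment l u (s + 1) t) * (- real l) ^ q))
    ({l+1..} \<times> {l+1..})"
proof -
  define c where "c q r s = fact k / (fact q * fact r * fact s) * (- real l) ^ q" for q r s
  define f where "f r s = (\<lambda>(n, j). (real n ^ (r + 1) * u n t) * (real j ^ (s + 1) * u j t))" for r s
  have f: "(f r s has_sum moment l u (r + 1) t * moment l u (s + 1) t) ({l+1..} \<times> {l+1..})" for r s
    unfolding f_def by (rule has_sum_moment_times_moment[OF t])
  have "((\<lambda>p. \<Sum>(q, r, s)\<in>{(q, r, s). q + r + s = k}. c q r s * f r s p) has_sum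
      (\<Sum>(q, r, s)\<in>{(q, r, s). q + r + s = k}.
        c q r s * (moment l u (r + 1) t * moment l u (s + 1) t))) ({l+1..} \<times> {l+1..})"
    unfolding case_prod_unfold
    by (rule has_sum_sum_finite[OF finite_triples_sum_eq[unfolded case_prod_unfold]])
      (rule has_sum_cmult_right[OF f])
  moreover have "(\<Sum>(q, r, s)\<in>{(q, r, s). q + r + s = k}. c q r s * f r s (n, j))
      = (real n + real j - real l) ^ k * real n * real j * u j t * u n t" for n j
  proof -
    have "(\<Sum>(q, r, s)\<in>{(q, r, s). q + r + s = k}. c q r s * f r s (n, j))
        = (- real l + real n + real j) ^ k * (real n * real j * u j t * u n t)"
      unfolding trinomial sum_distrib_right
      by (rule sum.cong) (auto simp: c_def f_def)
    also have "- real l + real n + real j = real n + real j - real l" by simp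
    finally show ?thesis by (simp only: mult.assoc)
  qed
  ultimately have "((\<lambda>(n, j). (real n + real j - real l) ^ k * real n * real j * u j t * u n t) has_sum
      (\<Sum>(q, r, s)\<in>{(q, r, s). q + r + s = k}.
        c q r s * (moment l u (r + 1) t * moment l u (s + 1) t))) ({l+1..} \<times> {l+1..})"
    by (elim back_subst[of "\<lambda>f. (f has_sum _) _"]) (simp add: fun_eq_iff)
  then show ?thesis
    by (simp add: c_def mult_ac)
qed

text \<open>Since i < n means exactly n + l - i > l, the finite inner sums together run once through
  all pairs of cluster sizes, and n = i + j - l turns the weight n^k into the power in the double
  sum.\<close>

lemma has_sum_rhs_gain:
  assumes t: "t \<in> {0..T}"
    and S: "((\<lambda>(n, j). (real n + real j - real l) ^ k * real n * real j * u j t * u n t) has_sum S)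
      ({l+1..} \<times> {l+1..})"
  shows "((\<lambda>n. real n ^ k * (\<Sum>i\<in>{l+1..<n}. real i * real (n + l - i) * u i t * u (n + l - i) t))
    has_sum S) {l+1..}"
proof (rule has_sum_SigmaD)
  let ?g = "\<lambda>(n, i). real n ^ k * (real i * real (n + l - i) * u i t * u (n + l - i) t)"
  have "(?g has_sum S) (Sigma {l+1..} (\<lambda>n. {l+1..<n})) \<longleftrightarrow>
    ((\<lambda>(n, j). (real n + real j - real l) ^ k * real n * real j * u j t * u n t) has_sum S)
      ({l+1..} \<times> {l+1..})"
    by (rule has_sum_reindex_bij_witness[of _ "\<lambda>(i, j). (i + j - l, i)" "\<lambda>(n, i). (i, n + l - i)"])
      (auto simp: of_nat_diff)
  then show "(?g has_sum S) (Sigma {l+1..} (\<lambda>n. {l+1..<n}))" using S by simp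
  show "((\<lambda>i. ?g (n, i)) has_sum
    real n ^ k * (\<Sum>i\<in>{l+1..<n}. real i * real (n + l - i) * u i t * u (n + l - i) t)) {l+1..<n}" for n
    by (rule has_sum_finiteI) (simp_all add: sum_distrib_left)
qed

end

section \<open>Combination of gain and loss\<close>

theorem theorem15:
  fixes l :: nat and T :: real and u0 :: "nat \<Rightarrow> real" and u :: "nat \<Rightarrow> real \<Rightarrow> real"
    and k :: nat and t :: real
  assumes "l \<ge> 1" and "T > 0"
    and "pre_gelation_solution l T u0 u"
    and "\<And>p. moment_converges_uniformly l T u p"
    and "k \<ge> 1" and "t \<in> {0..T}"
  shows "let A = (\<lambda>(n, j). ((real n + real j - real l) ^ k - 2 * real n ^ k)
                   * real n * real j * u j t * u n t);
             D = 1 / (moment l u 1 t)\<^sup>2 * (\<Sum>\<^sub>\<infinity>p\<in>{l+1..} \<times> {l+1..}. A p)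
         in A summable_on {l+1..} \<times> {l+1..} \<and>
            (moment l u k has_real_derivative D) (at t within {0..T}) \<and>
            D = - 2 * (moment l u (k + 1) t / moment l u 1 t)
                + (\<Sum>(q, r, s)\<in>{(q, r, s). q + r + s = k}.
                     fact k / (fact q * fact r * fact s)
                     * (moment l u (r + 1) t * moment l u (s + 1) t / (moment l u 1 t)\<^sup>2)
                     * (- real l) ^ q)"
proof -
  interpret moments_convergent l T u0 u
    using assms by unfold_locales (auto simp: pre_gelation_solution_def)
  note t = \<open>t \<in> {0..T}\<close>
  define A where "A = (\<lambda>(n, j). ((real n + real j - real l) ^ k - 2 * real n ^ k)
    * real n * real j * u j t * u n t)"
  define m where "m p = moment l u p t" for p
  define S where "S = (\<Sum>(q, r, s)\<in>{(q, r, s). q + r + s = k}.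
    fact k / (fact q * fact r * fact s) * (m (r + 1) * m (s + 1)) * (- real l) ^ q)"
  define D where "D = 1 / (m 1)\<^sup>2 * (\<Sum>\<^sub>\<infinity>p\<in>{l+1..} \<times> {l+1..}. A p)"
  have m1: "m 1 > 0" using moment_one_pos[OF t] by (simp add: m_def)
  note gain = has_sum_coagulation_gain[OF t, of k, folded m_def, folded S_def]
  \<comment> \<open>The loss part of \<open>A\<close> has summand 2 n^k n j u_j u_n, so its double
    sum factors as 2 m_{k+1} m_1; one factor m_1 later cancels against the denominator.\<close>
  have "((\<lambda>(n, j). (real n ^ (k + 1) * u n t) * (real j ^ 1 * u j t)) has_sum
      m (k + 1) * m 1) ({l+1..} \<times> {l+1..})"
    unfolding m_def by (rule has_sum_moment_times_moment[OF t])
  from has_sum_diff[OF gain has_sum_cmult_right[OF this, of 2]]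
  have A: "(A has_sum S - 2 * (m (k + 1) * m 1)) ({l+1..} \<times> {l+1..})"
    by (rule back_subst[of "\<lambda>f. (f has_sum _) _"]) (auto simp: A_def fun_eq_iff algebra_simps)
  have D: "D = S / (m 1)\<^sup>2 - 2 * (m (k + 1) / m 1)"
    using infsumI[OF A] m1 by (simp add: D_def field_simps power2_eq_square)
  have "((\<lambda>n. real n ^ k * large_cluster_rhs l u n t) has_sum D) {l+1..}"
  proof -
    \<comment> \<open>Here the loss is a single series with sum 2 m_{k+1} / m_1, which agrees with
      the loss part of \<open>D\<close> after that cancellation.\<close>
    have "((\<lambda>n. real n ^ k * (\<Sum>i\<in>{l+1..<n}. real i * real (n + l - i) * u i t * u (n + l - i) t)
          * (1 / (m 1)\<^sup>2) - real n ^ (k + 1) * u n t * (2 / m 1))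
        has_sum S * (1 / (m 1)\<^sup>2) - m (k + 1) * (2 / m 1)) {l+1..}"
      using has_sum_rhs_gain[OF t gain] has_sum_moment[OF t, of "k + 1", folded m_def]
      by (intro has_sum_diff has_sum_cmult_left)
    then show ?thesis
      unfolding D large_cluster_rhs_def m_def[symmetric]
      by (simp add: sum_distrib_left sum_distrib_right sum_divide_distrib right_diff_distrib diff_divide_distrib
          mult_ac)
  qed
  then have "(moment l u k has_real_derivative D) (at t within {0..T})"
    by (rule moment_deriv[OF t])
  moreover have "S / (m 1)\<^sup>2 = (\<Sum>(q, r, s)\<in>{(q, r, s). q + r + s = k}.
      fact k / (fact q * fact r * fact s) * (m (r + 1) * m (s + 1) / (m 1)\<^sup>2) * (- real l) ^ q)"
    by (simp add: S_def sum_divide_distrib case_prod_unfold)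
  ultimately show ?thesis
    using D has_sum_imp_summable[OF A]
    unfolding Let_def A_def[symmetric] m_def[symmetric] D_def[symmetric] by simp
qed

end
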